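(* Let $(X,\|\cdot\|,\succcurlyeq)$ be a regular partially ordered Banach space. Then every nonempty closed inductive subset $D$ of $X$ is chain-complete.
   Context: For a partial order $\succcurlyeq$ on $X$ write $[u)=\{x\in X: x\succcurlyeq u\}$ and $(w]=\{x\in X: x\preccurlyeq w\}$. A partially ordered Banach space $(X,\|\cdot\|,\succcurlyeq)$ is a real Banach space $X$ with a partial order $\succcurlyeq$ such that: (1) $x\succcurlyeq y$ implies $x+z\succcurlyeq y+z$ for all $x,y,z\in X$; (2) $x\succcurlyeq y$ implies $\alpha x\succcurlyeq\alpha y$ for all $x,y\in X$ and $\alpha\ge 0$; (3) there are distinct $x,y\in X$ with $x\succcurlyeq y$; and for every $u\in X$ the sets $[u)$ and $(u]$ are norm-closed. It is called regular if every $\succcurlyeq$-increasing sequence that has a $\succcurlyeq$-upper bound in $X$ is norm-convergent, i.e. $x_1\preccurlyeq x_2\preccurlyeq\cdots\preccurlyeq y$ for some $y\in X$ implies that there is $x\in X$ with $\|x_n-x\|\to 0$. A chain is a nonempty totally ordered subset. A subset $D\subseteq X$ is inductive if every chain in $D$ has a $\succcurlyeq$-upper bound in $D$. A subset $D$ is chain-complete if every chain in $D$ has the smallest $\succcurlyeq$-upper bound in $D$. Closed means closed in the norm topology. *)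

theory Defs
  imports "HOL-Analysis.Analysis"
begin

class partially_ordered_banach = banach + order +
  assumes translation_mono: "y \<le> x \<Longrightarrow> y + z \<le> x + z"
    and nonneg_scaleR_mono: "0 \<le> (\<alpha>::real) \<Longrightarrow> y \<le> x \<Longrightarrow> \<alpha> *\<^sub>R y \<le> \<alpha> *\<^sub>R x"
    and ex_distinct_comparable: "\<exists>x y. x \<noteq> y \<and> y \<le> x"
    and closed_up_set: "closed {u..}"
    and closed_down_set: "closed {..u}"

text \<open>
  The library's ordered vector spaces also demand monotonicity in the scalar, which follows
  from the two compatibility axioms above.
\<close>

instance partially_ordered_banach \<subseteq> ordered_real_vector
proof
  fix a b c :: 'a
  assume "a \<le> b"
  then show "c + a \<le> c + b"
    using translation_mono[of a b c] by (simp add: add.commute)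
next
  fix x y :: 'a and a :: real
  assume "x \<le> y" "0 \<le> a"
  then show "a *\<^sub>R x \<le> a *\<^sub>R y"
    by (simp add: nonneg_scaleR_mono)
next
  fix a b :: real and x :: 'a
  assume "a \<le> b" "0 \<le> x"
  then have "0 \<le> (b - a) *\<^sub>R x"
    using nonneg_scaleR_mono[of "b - a" 0 x] by simp
  then show "a *\<^sub>R x \<le> b *\<^sub>R x"
    using translation_mono[of 0 "(b - a) *\<^sub>R x" "a *\<^sub>R x"]
    by (simp add: scaleR_diff_left)
qed

class regular_partially_ordered_banach = partially_ordered_banach +
  assumes regular: "(\<And>n. X n \<le> X (Suc n)) \<Longrightarrow> (\<And>n. X n \<le> y) \<Longrightarrow> convergent X"

definition is_chain :: "'a::order set \<Rightarrow> bool" where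
  "is_chain C \<longleftrightarrow> C \<noteq> {} \<and> Complete_Partial_Order.chain (\<le>) C"

definition inductive_subset :: "'a::order set \<Rightarrow> bool" where
  "inductive_subset D \<longleftrightarrow> (\<forall>C. C \<subseteq> D \<and> is_chain C \<longrightarrow> (\<exists>b\<in>D. \<forall>c\<in>C. c \<le> b))"

text \<open>
  The smallest upper bound is taken in the poset \<open>D\<close>: it is compared only with the upper
  bounds that lie in \<open>D\<close>.
\<close>

definition chain_complete_subset :: "'a::order set \<Rightarrow> bool" where
  "chain_complete_subset D \<longleftrightarrow> (\<forall>C. C \<subseteq> D \<and> is_chain C \<longrightarrow>
     (\<exists>s\<in>D. (\<forall>c\<in>C. c \<le> s) \<and> (\<forall>b\<in>D. (\<forall>c\<in>C. c \<le> b) \<longrightarrow> s \<le> b)))"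

end

theory Submission
  imports Defs
begin

text \<open>
  By regularity, a chain bounded above is a Cauchy net: otherwise it would contain an increasing
  sequence whose consecutive terms stay a fixed distance apart. An increasing sequence in the
  chain along which the tails shrink to diameter zero converges by regularity, and its limit is
  the least upper bound of the chain; it lies in every closed set containing the chain.
\<close>

lemma chain_tails_arbitrarily_small:
  fixes C :: "'a::regular_partially_ordered_banach set"
  assumes "C \<noteq> {}" and bound: "\<And>c. c \<in> C \<Longrightarrow> c \<le> y" and "0 < e"
  obtains c where "c \<in> C" "\<And>d. d \<in> C \<Longrightarrow> c \<le> d \<Longrightarrow> dist c d < e"
proof (rule ccontr)
  assume "\<not> thesis"
  with that have far: "\<exists>d\<in>C. c \<le> d \<and> e \<le> dist c d" if "c \<in> C" for c
    using \<open>c \<in> C\<close> by (meson not_less)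
  have "\<exists>x. \<forall>n. x n \<in> C \<and> (x n \<le> x (Suc n) \<and> e \<le> dist (x n) (x (Suc n)))"
  proof (rule dependent_nat_choice)
    show "\<exists>x. x \<in> C" using \<open>C \<noteq> {}\<close> by blast
  qed (use far in blast)
  then obtain x where x: "\<And>n. x n \<in> C" "\<And>n. x n \<le> x (Suc n)"
      "\<And>n. e \<le> dist (x n) (x (Suc n))"
    by blast
  \<comment> \<open>The bound \<open>y\<close> on \<open>C\<close> also bounds \<open>x\<close>, so
    regularity makes \<open>x\<close> convergent; the gap between the terms \<open>N\<close> and
    \<open>Suc N\<close> then contradicts the Cauchy property.\<close>
  have "Cauchy x"
    using regular[of x y] x bound by (simp add: convergent_Cauchy)
  then obtain N where "\<And>m n. N \<le> m \<Longrightarrow> N \<le> n \<Longrightarrow> dist (x m) (x n) < e"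
    using \<open>0 < e\<close> by (meson metric_CauchyD)
  then show False
    using x(3)[of N] by (meson le_SucI not_less order_refl)
qed

text \<open>Leastness is over all upper bounds in the space, so it restricts to the upper bounds in
  any subset; membership in the closure is what places \<open>s\<close> in a closed superset of
  \<open>C\<close>.\<close>

lemma bounded_chain_has_sup_in_closure:
  fixes C :: "'a::regular_partially_ordered_banach set"
  assumes "is_chain C" and bound: "\<And>c. c \<in> C \<Longrightarrow> c \<le> y"
  shows "\<exists>s\<in>closure C. (\<forall>c\<in>C. c \<le> s) \<and> (\<forall>b. (\<forall>c\<in>C. c \<le> b) \<longrightarrow> s \<le> b)"
proof -
  have "C \<noteq> {}" and linear: "\<And>c d. c \<in> C \<Longrightarrow> d \<in> C \<Longrightarrow> c \<le> d \<or> d \<le> c"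
    using \<open>is_chain C\<close> by (auto simp: is_chain_def chain_def)
  define small where
    "small n c \<longleftrightarrow> c \<in> C \<and> (\<forall>d\<in>C. c \<le> d \<longrightarrow> dist c d < inverse (real (Suc n)))" for n c
  \<comment> \<open>Smallness must be attainable above any given element, so that the chosen
    sequence can be increasing.\<close>
  have small_above: "\<exists>d. small n d \<and> c \<le> d" if "c \<in> C" for n c
  proof -
    \<comment> \<open>Half the radius: two elements above \<open>a\<close> are each within half of
      \<open>a\<close>, so smallness passes from \<open>a\<close> to everything above it in
      \<open>C\<close>. The larger of \<open>a\<close> and \<open>c\<close> is then the
      witness.\<close>
    obtain a where a: "a \<in> C" "\<And>d. d \<in> C \<Longrightarrow> a \<le> d \<Longrightarrow> dist a d < inverse (real (Suc n)) / 2"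
      by (rule chain_tails_arbitrarily_small[of C y "inverse (real (Suc n)) / 2"])
        (use \<open>C \<noteq> {}\<close> bound in auto)
    have small: "small n d" if "d \<in> C" "a \<le> d" for d
      unfolding small_def
    proof (intro conjI ballI impI)
      fix d' assume "d' \<in> C" "d \<le> d'"
      then show "dist d d' < inverse (real (Suc n))"
        using a(2)[of d] a(2)[of d'] that dist_triangle3[of d d' a] by fastforce
    qed fact
    show ?thesis
      using linear[OF \<open>a \<in> C\<close> \<open>c \<in> C\<close>] small a(1) \<open>c \<in> C\<close> by blast
  qed
  have "\<exists>x. \<forall>n. small n (x n) \<and> x n \<le> x (Suc n)"
  proof (rule dependent_nat_choice)
    show "\<exists>x. small 0 x"
      using \<open>C \<noteq> {}\<close> small_above by blast
    show "\<exists>d. small (Suc n) d \<and> c \<le> d" if "small n c" for c n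
      using that small_above unfolding small_def by blast
  qed
  then obtain x where small: "\<And>n. small n (x n)" and step: "\<And>n. x n \<le> x (Suc n)"
    by blast
  have in_C: "x n \<in> C" for n
    using small small_def by blast
  obtain s where lim: "x \<longlonglongrightarrow> s"
    using regular[of x y] step bound in_C by (auto simp: convergent_def)
  show ?thesis
  proof (intro bexI[of _ s] conjI ballI allI impI)
    show "s \<in> closure C"
      using lim in_C closure_sequential by blast
  next
    fix c assume "c \<in> C"
    show "c \<le> s"
    \<comment> \<open>If some term dominates \<open>c\<close>, so do all later ones, and closedness
      of \<open>{c..}\<close> passes this to the limit.\<close>
    proof (cases "\<exists>n. c \<le> x n")
      case True
      then obtain N where "c \<le> x N" ..
      then have "\<forall>\<^sub>F n in sequentially. x n \<in> {c..}"
        using lift_Suc_mono_le[of x, OF step]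
        by (auto intro!: eventually_sequentiallyI[of N] intro: order_trans)
      from Lim_in_closed_set[OF closed_up_set this _ lim] show ?thesis
        by simp
    next
      \<comment> \<open>Here \<open>c\<close> is above every \<open>x n\<close>, hence in every
        small tail, so \<open>x\<close> converges to \<open>c\<close> and \<open>c\<close> equals
        \<open>s\<close>.\<close>
      case False
      then have "x n \<le> c" for n
        using linear in_C \<open>c \<in> C\<close> by blast
      then have "dist (x n) c < inverse (real (Suc n))" for n
        using small \<open>c \<in> C\<close> unfolding small_def by blast
      then have "(\<lambda>n. dist (x n) c) \<longlonglongrightarrow> 0"
        by (intro tendsto_sandwich[OF _ _ tendsto_const LIMSEQ_inverse_real_of_nat])
          (auto intro!: always_eventually less_imp_le)
      then have "x \<longlonglongrightarrow> c"
        using tendsto_dist_iff by blast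
      with lim show ?thesis
        using LIMSEQ_unique by blast
    qed
  next
    fix b assume "\<forall>c\<in>C. c \<le> b"
    then have "\<forall>\<^sub>F n in sequentially. x n \<in> {..b}"
      using in_C by simp
    from Lim_in_closed_set[OF closed_down_set this _ lim] show "s \<le> b"
      by simp
  qed
qed

theorem theorem3p1:
  fixes D :: "'a::regular_partially_ordered_banach set"
  assumes "D \<noteq> {}"
    and "closed D"
    and "inductive_subset D"
  shows "chain_complete_subset D"
  unfolding chain_complete_subset_def
proof (intro allI impI, elim conjE)
  fix C assume "C \<subseteq> D" "is_chain C"
  \<comment> \<open>Inductivity supplies only some upper bound, which is what regularity asks
    for.\<close>
  then obtain y where "\<And>c. c \<in> C \<Longrightarrow> c \<le> y"
    using \<open>inductive_subset D\<close> unfolding inductive_subset_def by blast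
  from bounded_chain_has_sup_in_closure[OF \<open>is_chain C\<close> this]
  show "\<exists>s\<in>D. (\<forall>c\<in>C. c \<le> s) \<and> (\<forall>b\<in>D. (\<forall>c\<in>C. c \<le> b) \<longrightarrow> s \<le> b)"
    using closure_minimal[OF \<open>C \<subseteq> D\<close> \<open>closed D\<close>] by blast
qed

end
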